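(* Let $A,B\in\mathbb{R}^{m\times n}$ with $m<n$ and $b\in\mathbb{R}^m$, and let $1\le p\le\infty$. Let $A = M_A - N_A$ with $\operatorname{rank}(M_A) =m$. If $M_A^\dagger b\geq0$, $M_A^\dagger (N_A + B) \geq 0$ and $\|M_A^\dagger (N_A + B)\|_p <1$, then the equation $Ax-B|x|=b$ has at least one nonnegative solution.
   Context: $M^\dagger$ is the Moore–Penrose inverse; $|x|$ is the entrywise absolute value; vector/matrix inequalities are entrywise; $\|\cdot\|_p$ on matrices is the operator norm induced by the vector $p$-norm. *)

theory Defs
  imports "HOL-Analysis.Analysis" "HOL-Library.Extended_Real"
begin

text \<open>Moore--Penrose inverse, defined by the four Penrose conditions.\<close>
definition mp_pinv :: "real^'n^'m \<Rightarrow> real^'m^'n" where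
  "mp_pinv M = (THE X. M ** X ** M = M \<and> X ** M ** X = X \<and>
       transpose (M ** X) = M ** X \<and> transpose (X ** M) = X ** M)"

text \<open>Vector p-norm for p in [1, infinity] (p an extended real).\<close>
definition vec_pnorm :: "ereal \<Rightarrow> real^'n \<Rightarrow> real" where
  "vec_pnorm p x = (if p = \<infinity> then Max (range (\<lambda>i. \<bar>x $ i\<bar>))
      else (\<Sum>i\<in>UNIV. \<bar>x $ i\<bar> powr real_of_ereal p) powr (1 / real_of_ereal p))"

text \<open>Operator norm induced by the vector p-norm.\<close>
definition mat_pnorm :: "ereal \<Rightarrow> real^'n^'m \<Rightarrow> real" where
  "mat_pnorm p M = Sup {vec_pnorm p (M *v x) | x. vec_pnorm p x = 1}"

definition vabs :: "real^'n \<Rightarrow> real^'n" where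
  "vabs x = (\<chi> i. \<bar>x $ i\<bar>)"

definition vnonneg :: "real^'n \<Rightarrow> bool" where
  "vnonneg x \<longleftrightarrow> (\<forall>i. 0 \<le> x $ i)"

definition mnonneg :: "real^'n^'m \<Rightarrow> bool" where
  "mnonneg M \<longleftrightarrow> (\<forall>i j. 0 \<le> M $ i $ j)"

end

theory Submission
  imports Defs
begin

(* Put C = M_A^+ (N_A + B) and c = M_A^+ b. Full row rank makes M_A^+ a right inverse of M_A,
   so every solution of x = C x + c satisfies M_A x = (N_A + B) x + b, i.e. A x - B x = b.
   Since ||C||_p < 1, no nonzero y has ||y||_p <= ||C y||_p; hence I - C is injective and
   such an x exists. Its negative part z satisfies z <= C z entrywise because C >= 0 and
   c >= 0, so z = 0: x is nonnegative and |x| = x. *)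

lemma ereal_ge_1_cases:
  assumes "1 \<le> p"
  obtains "p = \<infinity>" | r where "p = ereal r" "1 \<le> r"
  using assms by (cases p) auto

lemma abs_component_le_vec_pnorm:
  assumes "1 \<le> p"
  shows "\<bar>x $ i\<bar> \<le> vec_pnorm p x"
  using assms
proof (cases rule: ereal_ge_1_cases)
  case 1
  then show ?thesis by (simp add: vec_pnorm_def)
next
  case (2 r)
  have "\<bar>x $ i\<bar> = (\<bar>x $ i\<bar> powr r) powr (1 / r)"
    using \<open>1 \<le> r\<close> by (simp add: powr_powr)
  also have "\<dots> \<le> (\<Sum>j\<in>UNIV. \<bar>x $ j\<bar> powr r) powr (1 / r)"
    using \<open>1 \<le> r\<close> by (intro powr_mono2 member_le_sum) auto
  finally show ?thesis using 2 by (simp add: vec_pnorm_def)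
qed

lemma vec_pnorm_nonneg: "1 \<le> p \<Longrightarrow> 0 \<le> vec_pnorm p x"
  using abs_component_le_vec_pnorm[of p x undefined] by linarith

lemma vec_pnorm_mono:
  assumes "1 \<le> p" and "\<And>i. \<bar>u $ i\<bar> \<le> \<bar>v $ i\<bar>"
  shows "vec_pnorm p u \<le> vec_pnorm p v"
  using assms(1)
proof (cases rule: ereal_ge_1_cases)
  case 1
  have "\<bar>u $ i\<bar> \<le> Max (range (\<lambda>i. \<bar>v $ i\<bar>))" for i
  proof -
    have "\<bar>v $ i\<bar> \<le> Max (range (\<lambda>i. \<bar>v $ i\<bar>))" by (rule Max_ge) auto
    then show ?thesis using assms(2)[of i] by linarith
  qed
  then show ?thesis using 1 by (simp add: vec_pnorm_def)
next
  case (2 r)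
  have "(\<Sum>j\<in>UNIV. \<bar>u $ j\<bar> powr r) \<le> (\<Sum>j\<in>UNIV. \<bar>v $ j\<bar> powr r)"
    using \<open>1 \<le> r\<close> assms(2) by (intro sum_mono powr_mono2) auto
  then show ?thesis
    using 2 by (simp add: vec_pnorm_def powr_mono2 sum_nonneg)
qed

lemma vec_pnorm_scaleR:
  assumes "1 \<le> p" and "0 \<le> t"
  shows "vec_pnorm p (t *\<^sub>R x) = t * vec_pnorm p x"
  using assms(1)
proof (cases rule: ereal_ge_1_cases)
  case 1
  have "range (\<lambda>i. \<bar>(t *\<^sub>R x) $ i\<bar>) = (*) t ` range (\<lambda>i. \<bar>x $ i\<bar>)"
    using assms(2) by (auto simp: abs_mult image_image)
  moreover have "t * Max (range (\<lambda>i. \<bar>x $ i\<bar>)) = Max ((*) t ` range (\<lambda>i. \<bar>x $ i\<bar>))"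
    using assms(2) by (intro mono_Max_commute) (auto simp: mono_def mult_left_mono)
  ultimately show ?thesis using 1 by (simp add: vec_pnorm_def)
next
  case (2 r)
  have "(\<Sum>j\<in>UNIV. \<bar>(t *\<^sub>R x) $ j\<bar> powr r) = t powr r * (\<Sum>j\<in>UNIV. \<bar>x $ j\<bar> powr r)"
    using assms(2) by (simp add: abs_mult powr_mult sum_distrib_left)
  moreover have "(t powr r) powr (1 / r) = t"
    using \<open>1 \<le> r\<close> assms(2) by (simp add: powr_powr)
  ultimately show ?thesis
    using 2 by (simp add: vec_pnorm_def powr_mult sum_nonneg)
qed

lemma vec_pnorm_eq_0_iff:
  assumes "1 \<le> p"
  shows "vec_pnorm p x = 0 \<longleftrightarrow> x = 0"
proof
  assume "vec_pnorm p x = 0"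
  then show "x = 0"
    using abs_component_le_vec_pnorm[OF assms, of x] by (simp add: vec_eq_iff)
next
  assume "x = 0"
  then show "vec_pnorm p x = 0"
    using vec_pnorm_scaleR[OF assms order_refl, of x] by simp
qed

lemma bdd_above_mat_pnorm:
  fixes C :: "real^'n^'m"
  assumes "1 \<le> p"
  shows "bdd_above {vec_pnorm p (C *v x) | x. vec_pnorm p x = 1}"
proof (rule bdd_aboveI, safe)
  fix x :: "real^'n"
  assume x: "vec_pnorm p x = 1"
  define k :: "real^'m" where "k = (\<chi> i. \<Sum>j\<in>UNIV. \<bar>C $ i $ j\<bar>)"
  have "\<bar>(C *v x) $ i\<bar> \<le> \<bar>k $ i\<bar>" for i
  proof -
    have "\<bar>(C *v x) $ i\<bar> \<le> (\<Sum>j\<in>UNIV. \<bar>C $ i $ j\<bar> * \<bar>x $ j\<bar>)"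
      by (simp add: matrix_vector_mult_def sum_abs[THEN order_trans] abs_mult)
    also have "\<dots> \<le> (\<Sum>j\<in>UNIV. \<bar>C $ i $ j\<bar>)"
      using abs_component_le_vec_pnorm[OF assms, of x] x
      by (intro sum_mono) (simp add: mult_left_le)
    finally show ?thesis by (simp add: k_def sum_nonneg)
  qed
  then show "vec_pnorm p (C *v x) \<le> vec_pnorm p k"
    by (rule vec_pnorm_mono[OF assms])
qed

lemma vec_pnorm_matrix_vector_le:
  fixes C :: "real^'n^'m"
  assumes p: "1 \<le> p"
  shows "vec_pnorm p (C *v y) \<le> mat_pnorm p C * vec_pnorm p y"
proof (cases "y = 0")
  case True
  then show ?thesis
    using vec_pnorm_eq_0_iff[OF p, of y] vec_pnorm_eq_0_iff[OF p, of "C *v y"] by simp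
next
  case False
  define s where "s = vec_pnorm p y"
  have "0 < s"
    using False vec_pnorm_nonneg[OF p, of y] vec_pnorm_eq_0_iff[OF p, of y] by (simp add: s_def)
  have "vec_pnorm p ((1 / s) *\<^sub>R y) = 1"
    using \<open>0 < s\<close> by (simp add: vec_pnorm_scaleR[OF p] s_def)
  then have "vec_pnorm p (C *v ((1 / s) *\<^sub>R y)) \<le> mat_pnorm p C"
    unfolding mat_pnorm_def by (intro cSup_upper bdd_above_mat_pnorm[OF p]) blast
  then have "vec_pnorm p (C *v y) / s \<le> mat_pnorm p C"
    using \<open>0 < s\<close> by (simp add: matrix_vector_mult_scaleR vec_pnorm_scaleR[OF p])
  then show ?thesis
    using \<open>0 < s\<close> by (simp add: s_def pos_divide_le_eq)
qed

definition is_moore_penrose_inverse :: "real^'n^'m \<Rightarrow> real^'m^'n \<Rightarrow> bool" where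
  "is_moore_penrose_inverse M X \<longleftrightarrow> M ** X ** M = M \<and> X ** M ** X = X \<and>
       transpose (M ** X) = M ** X \<and> transpose (X ** M) = X ** M"

lemma moore_penrose_inverse_unique:
  assumes X: "is_moore_penrose_inverse M X" and Y: "is_moore_penrose_inverse M Y"
  shows "X = Y"
proof -
  have MYM: "M ** Y ** M = M" and YMY: "Y ** M ** Y = Y"
    and MY: "transpose (M ** Y) = M ** Y" and YM: "transpose (Y ** M) = Y ** M"
    using Y by (simp_all add: is_moore_penrose_inverse_def)
  have MXM: "M ** X ** M = M" and XMX: "X ** M ** X = X"
    and MX: "transpose (M ** X) = M ** X" and XM: "transpose (X ** M) = X ** M"
    using X by (simp_all add: is_moore_penrose_inverse_def)
  \<comment> \<open>both X and Y turn out to equal X M Y\<close>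
  have "transpose M = transpose M ** (M ** Y)"
    by (metis MY MYM matrix_mul_assoc matrix_transpose_mul)
  then have "X = X ** M ** Y"
    by (metis MX XMX matrix_mul_assoc matrix_transpose_mul)
  moreover have "transpose M = (X ** M) ** transpose M"
    by (metis XM MXM matrix_mul_assoc matrix_transpose_mul)
  then have "Y = X ** M ** Y"
    by (metis YM YMY matrix_mul_assoc matrix_transpose_mul)
  ultimately show ?thesis by simp
qed

lemma mp_pinv_eqI: "is_moore_penrose_inverse M X \<Longrightarrow> mp_pinv M = X"
  unfolding mp_pinv_def
  by (rule the_equality)
    (auto simp: moore_penrose_inverse_unique is_moore_penrose_inverse_def[symmetric])

lemma matrix_inv_mult:
  assumes "invertible A"
  shows "A ** matrix_inv A = mat 1" and "matrix_inv A ** A = mat 1"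
proof -
  have "A ** matrix_inv A = mat 1 \<and> matrix_inv A ** A = mat 1"
    unfolding matrix_inv_def by (rule someI_ex) (use assms in \<open>simp add: invertible_def\<close>)
  then show "A ** matrix_inv A = mat 1" and "matrix_inv A ** A = mat 1" by simp_all
qed

lemma transpose_matrix_inv_symmetric:
  fixes G :: "real^'n^'n"
  assumes "invertible G" and "transpose G = G"
  shows "transpose (matrix_inv G) = matrix_inv G"
proof -
  have "transpose (matrix_inv G) ** G = mat 1"
    using matrix_inv_mult(1)[OF assms(1)] assms(2) by (metis matrix_transpose_mul transpose_mat)
  then show ?thesis
    by (metis matrix_inv_mult(1)[OF assms(1)] matrix_mul_assoc matrix_mul_lid matrix_mul_rid)
qed

lemma invertible_mult_transpose_full_row_rank:
  fixes M :: "real^'n^'m"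
  assumes "rank M = CARD('m)"
  shows "invertible (M ** transpose M)"
proof -
  have "inj ((*v) (transpose M))"
    using assms by (simp add: full_rank_injective[symmetric] rank_transpose)
  have "y = 0" if "(M ** transpose M) *v y = 0" for y
  proof -
    have "inner (transpose M *v y) (transpose M *v y) = inner y ((M ** transpose M) *v y)"
      by (simp add: matrix_vector_mul_assoc[symmetric] dot_lmul_matrix[symmetric])
    then have "transpose M *v y = 0" using that by simp
    then show "y = 0"
      using \<open>inj ((*v) (transpose M))\<close> by (metis injD matrix_vector_mult_0_right)
  qed
  then show ?thesis
    by (simp add: invertible_left_inverse matrix_left_invertible_ker)
qed

lemma is_moore_penrose_inverse_full_row_rank:
  fixes M :: "real^'n^'m"
  assumes "rank M = CARD('m)"
  shows "is_moore_penrose_inverse M (transpose M ** matrix_inv (M ** transpose M))"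
proof -
  define G where "G = M ** transpose M"
  have "invertible G"
    using assms by (simp add: G_def invertible_mult_transpose_full_row_rank)
  moreover have "transpose G = G"
    by (simp add: G_def matrix_transpose_mul)
  ultimately have "transpose (matrix_inv G) = matrix_inv G"
    by (rule transpose_matrix_inv_symmetric)
  moreover have "M ** (transpose M ** matrix_inv G) = mat 1"
    using matrix_inv_mult(1)[OF \<open>invertible G\<close>] by (simp add: G_def matrix_mul_assoc)
  ultimately show ?thesis
    unfolding G_def[symmetric] is_moore_penrose_inverse_def
    by (simp add: matrix_mul_assoc[symmetric] matrix_transpose_mul)
qed

lemma mp_pinv_right_inverse:
  fixes M :: "real^'n^'m"
  assumes "rank M = CARD('m)"
  shows "M ** mp_pinv M = mat 1"
  using mp_pinv_eqI[OF is_moore_penrose_inverse_full_row_rank[OF assms]]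
    matrix_inv_mult(1)[OF invertible_mult_transpose_full_row_rank[OF assms]]
  by (simp add: matrix_mul_assoc)

lemma vec_pnorm_le_contraction_imp_eq_0:
  fixes C :: "real^'n^'m"
  assumes p: "1 \<le> p" and "mat_pnorm p C < 1"
    and "vec_pnorm p y \<le> vec_pnorm p (C *v y)"
  shows "y = 0"
proof -
  have "vec_pnorm p y \<le> mat_pnorm p C * vec_pnorm p y"
    using assms(3) vec_pnorm_matrix_vector_le[OF p, of C y] by linarith
  then have "vec_pnorm p y = 0"
    using assms(2) vec_pnorm_nonneg[OF p, of y] by (smt (verit) mult_le_cancel_right1)
  then show ?thesis using vec_pnorm_eq_0_iff[OF p] by blast
qed

lemma contraction_affine_fixpoint_exists:
  fixes C :: "real^'n^'n"
  assumes p: "1 \<le> p" and "mat_pnorm p C < 1"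
  obtains x where "x = C *v x + c"
proof -
  have "y = 0" if "(mat 1 - C) *v y = 0" for y
    using that vec_pnorm_le_contraction_imp_eq_0[OF assms, of y]
    by (simp add: matrix_vector_mult_diff_rdistrib)
  then have "inj ((*v) (mat 1 - C))"
    by (simp add: matrix_left_invertible_injective[symmetric] matrix_left_invertible_ker)
  then have "surj ((*v) (mat 1 - C))"
    by (simp add: full_rank_injective[symmetric] full_rank_surjective[symmetric])
  then obtain x where "(mat 1 - C) *v x = c" by (metis surjD)
  then show ?thesis
    by (intro that) (simp add: matrix_vector_mult_diff_rdistrib algebra_simps)
qed

lemma negative_part_le_matrix_vector:
  fixes C :: "real^'n^'n"
  assumes C: "mnonneg C" and c: "vnonneg c" and x: "x = C *v x + c"
  shows "max (- x $ i) 0 \<le> (C *v (\<chi> j. max (- x $ j) 0)) $ i"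
proof -
  have "- x $ i = (\<Sum>j\<in>UNIV. C $ i $ j * - x $ j) - c $ i"
    using arg_cong[OF x, of "\<lambda>v. v $ i"]
    by (simp add: matrix_vector_mult_def sum_negf)
  also have "\<dots> \<le> (\<Sum>j\<in>UNIV. C $ i $ j * max (- x $ j) 0)"
    using C c unfolding mnonneg_def vnonneg_def
    by (smt (verit) sum_mono mult_left_mono max.cobounded1)
  finally show ?thesis
    using C unfolding mnonneg_def
    by (simp add: matrix_vector_mult_def sum_nonneg)
qed

lemma contraction_affine_fixpoint_nonneg:
  fixes C :: "real^'n^'n"
  assumes p: "1 \<le> p" and "mat_pnorm p C < 1"
    and "mnonneg C" and "vnonneg c" and "x = C *v x + c"
  shows "vnonneg x"
proof -
  define z :: "real^'n" where "z = (\<chi> j. max (- x $ j) 0)"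
  have "0 \<le> z $ i" and "z $ i \<le> (C *v z) $ i" for i
    using negative_part_le_matrix_vector[OF assms(3-5), of i] by (simp_all add: z_def)
  then have "vec_pnorm p z \<le> vec_pnorm p (C *v z)"
    by (intro vec_pnorm_mono[OF p]) (metis abs_of_nonneg abs_ge_self order_trans)
  then have "z = 0"
    by (rule vec_pnorm_le_contraction_imp_eq_0[OF p assms(2)])
  then have "max (- x $ i) 0 = 0" for i
    by (simp add: z_def vec_eq_iff)
  then show ?thesis
    unfolding vnonneg_def by (metis max.absorb_iff2 neg_le_0_iff_le)
qed

theorem corollary3p6:
  fixes A B M\<^sub>A N\<^sub>A :: "real^'n^'m" and b :: "real^'m" and p :: ereal
  assumes "CARD('m) < CARD('n)"
    and "1 \<le> p"
    and "A = M\<^sub>A - N\<^sub>A"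
    and "rank M\<^sub>A = CARD('m)"
    and "vnonneg (mp_pinv M\<^sub>A *v b)"
    and "mnonneg (mp_pinv M\<^sub>A ** (N\<^sub>A + B))"
    and "mat_pnorm p (mp_pinv M\<^sub>A ** (N\<^sub>A + B)) < 1"
  shows "\<exists>x. vnonneg x \<and> A *v x - B *v vabs x = b"
proof -
  define C where "C = mp_pinv M\<^sub>A ** (N\<^sub>A + B)"
  obtain x where x: "x = C *v x + mp_pinv M\<^sub>A *v b"
    using contraction_affine_fixpoint_exists[OF assms(2) assms(7)[folded C_def]] .
  have "vnonneg x"
    using contraction_affine_fixpoint_nonneg[OF assms(2) assms(7,6,5)[folded C_def] x] .
  then have "vabs x = x"
    by (simp add: vabs_def vnonneg_def vec_eq_iff)
  have "M\<^sub>A *v x = (M\<^sub>A ** mp_pinv M\<^sub>A) *v ((N\<^sub>A + B) *v x + b)"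
    by (subst x) (simp add: C_def matrix_vector_mul_assoc[symmetric] matrix_vector_right_distrib)
  also have "\<dots> = N\<^sub>A *v x + B *v x + b"
    by (simp add: mp_pinv_right_inverse[OF assms(4)] matrix_vector_mult_add_rdistrib)
  finally have "A *v x - B *v vabs x = b"
    using \<open>vabs x = x\<close> assms(3) by (simp add: matrix_vector_mult_diff_rdistrib)
  with \<open>vnonneg x\<close> show ?thesis by blast
qed

end
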